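(* Let $p=(F,X,\Gamma)$ be a balanced preseed of rank $n$ in $\mathcal{D}_n$, with $F=\{F_1,\dots,F_n\}$ and $X=\{x_1,\dots,x_n\}$, and let $q\in K$ be a nonzero element such that $$f x_i=q\,x_i f\qquad\text{for every } i\in[1,n]\text{ and every frozen variable } f\in F_i .$$ Then the set $\mathcal{X}(p)$ of all cluster variables of $p$ is finite if and only if $q$ is an $m$-th root of unity for some natural number $m$.
   Context: Throughout, $K$ is a field of characteristic zero and $[1,k]=\{1,\dots,k\}$. Ambient rings. For $i\in[1,n]$ let $F_i=\{f_{i1},\dots,f_{im_i}\}$ be a finite set of "frozen variables"; $\mathbb{P}_i$ is the free abelian group (written multiplicatively) with generating set $F_1\cup\dots\cup F_i$, and $R_i=K[\mathbb{P}_i]$ is its group ring. $D_1\subset D_2\subset\dots\subset D_n$ are Ore domains with $R_i\subset D_i$, together with elements $t_i\in D_i$ (with $t_i^{-1}\in D_i$) such that $t_it_j=t_jt_i$ and $t_if_{jr}=f_{jr}t_i$ for all $i\ne j$ and $r\in[1,m_j]$, and the monomials $t_1^{\alpha_1}\cdots t_i^{\alpha_i}$, $\alpha_1,\dots,\alpha_i\in\mathbb{Z}$, form a basis of $D_i$ as a left $R_i$-module. $\mathcal{D}_i$ is the division ring of right fractions $ab^{-1}$, $a,b\in D_i$, $b\neq0$; so $\mathcal{D}_1\subset\dots\subset\mathcal{D}_n$. Star quivers. A valued quiver has vertices, arrows (no loops, no 2-cycles), and each arrow $i\to j$ carries a valuation $(v_{ij},v_{ji})$ of positive integers, for which there are positive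 integers $d_i$ with $d_iv_{ij}=v_{ji}d_j$. It is a star quiver with center $k$ if every arrow starts or ends at $k$. A star quiver with center $k$ is balanced with frozen component $a_k\in\mathbb{Z}_{\ge0}$ if $\sum_{k\to j}v_{kj}=\sum_{k\to j}v_{jk}=\sum_{i\to k}v_{ik}=\sum_{i\to k}v_{ki}=a_k$. Preseeds. A preseed of rank $n$ in $\mathcal{D}_n$ is a triple $(F,X,\Gamma)$ with $F=\{F_1,\dots,F_n\}$, $X=\{x_1,\dots,x_n\}$, $\Gamma=\{\Gamma_1,\dots,\Gamma_n\}$ such that for each $k$: $x_k\in\mathcal{D}_k$ is the image of $t_k$ under some $R_k$-linear automorphism of $\mathcal{D}_k$ fixing the frozen variables, and $\Gamma_k$ is a star quiver with $m_k+1$ vertices, whose center corresponds to $x_k$ and whose other vertices correspond to $f_{k1},\dots,f_{km_k}$. The $x_k$ are the (initial) exchange cluster variables. The preseed is balanced if each $\Gamma_k$ is balanced. Mutations. Put $\xi_k=\prod_{j\to k}f_{kj}^{v_{jk}}+\prod_{k\to j}f_{kj}^{v_{kj}}$ (products over the arrows of $\Gamma_k$ into, respectively out of, its center $k$). The right mutation $\mu_k^R$ (left mutation $\mu^L_k$) replaces $x_k$ by $\xi_kx_k^{-1}$ (by $x_k^{-1}\xi_k$), keeps $x_i$ for $i\neq k$, keeps $F$, and replaces $\Gamma_k$ by the quiver with all arrows reversed (components of the valuations switched), keeping the other $\Gamma_i$. A cluster variable of $p$ is an element of some cluster obtained from $p$ by a finite (possibly empty) sequence of right or left mutations; $\mathcal{X}(p)$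 is the set of all of them.
   Formalization: Some Γ_k is assumed to have an arrow (if all a_k=0, X(p) is finite for every q). Reversing arrows swaps the numbers v_ij and v_ji, so ξ_k is unchanged by mutation; if these numbers were kept, the claim would fail for unequal valuations. *)

theory Defs
  imports "HOL-Library.Poly_Mapping"
begin

section \<open>Group rings of free abelian groups\<close>

text \<open>
  The free abelian group on \<open>'f\<close>, written additively, is \<open>'f \<Rightarrow>\<^sub>0 int\<close>, and its group
  ring over \<open>'k\<close> consists of the finitely supported functions from it to \<open>'k\<close> with the
  convolution product.
\<close>

type_synonym ('f, 'k) group_ring = "('f \<Rightarrow>\<^sub>0 int) \<Rightarrow>\<^sub>0 'k"

definition group_ring_on :: "'f set \<Rightarrow> ('f, 'k::zero) group_ring set" where
  "group_ring_on S = {p. \<forall>u \<in> Poly_Mapping.keys p. Poly_Mapping.keys u \<subseteq> S}"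

definition frozen_var :: "'f \<Rightarrow> ('f, 'k::comm_ring_1) group_ring" where
  "frozen_var f = Poly_Mapping.single (Poly_Mapping.single f 1) 1"

definition scalar :: "'k \<Rightarrow> ('f, 'k::comm_ring_1) group_ring" where
  "scalar c = Poly_Mapping.single 0 c"

abbreviation R_ring :: "(nat \<Rightarrow> 'f set) \<Rightarrow> nat \<Rightarrow> ('f, 'k::zero) group_ring set" where
  "R_ring F i \<equiv> group_ring_on (\<Union>j\<in>{1..i}. F j)"


section \<open>Ore domains and the ambient tower\<close>

text \<open>
  All rings of the tower lie in one division ring \<open>'d\<close>, which may be larger than the
  division ring of fractions of the top ring. The absence of zero divisors is thus automatic.
\<close>

definition subring_of :: "'d::ring_1 set \<Rightarrow> bool" where
  "subring_of A \<longleftrightarrow> 1 \<in> A \<and> (\<forall>a\<in>A. \<forall>b\<in>A. a - b \<in> A \<and> a * b \<in> A)"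

text \<open>The Ore condition is the one that makes right fractions available.\<close>

definition Ore_domain :: "'d::division_ring set \<Rightarrow> bool" where
  "Ore_domain A \<longleftrightarrow> subring_of A \<and>
     (\<forall>a\<in>A - {0}. \<forall>b\<in>A - {0}. \<exists>c\<in>A. \<exists>d\<in>A. a * c = b * d \<and> a * c \<noteq> 0)"

definition right_fractions :: "'d::division_ring set \<Rightarrow> 'd set" where
  "right_fractions A = {a * inverse b | a b. a \<in> A \<and> b \<in> A \<and> b \<noteq> 0}"

definition exponents :: "nat \<Rightarrow> (nat \<Rightarrow> int) set" where
  "exponents i = {\<alpha>. \<forall>j. j \<notin> {1..i} \<longrightarrow> \<alpha> j = 0}"

definition t_monomial :: "(nat \<Rightarrow> 'd::division_ring) \<Rightarrow> nat \<Rightarrow> (nat \<Rightarrow> int) \<Rightarrow> 'd" where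
  "t_monomial t i \<alpha> = prod_list (map (\<lambda>j. t j powi \<alpha> j) [1..<Suc i])"

text \<open>
  \<open>\<iota>\<close> is the inclusion of the group rings \<open>R_ring F i\<close> into the \<open>D i\<close>; only its values on
  \<open>R_ring F n\<close> matter. The sets \<open>F i\<close> need not be disjoint.
\<close>

locale ambient_tower =
  fixes n :: nat
    and F :: "nat \<Rightarrow> 'f set"
    and \<iota> :: "('f, 'k::field_char_0) group_ring \<Rightarrow> 'd::division_ring"
    and D :: "nat \<Rightarrow> 'd set"
    and t :: "nat \<Rightarrow> 'd"
  assumes finite_frozen: "\<And>i. i \<in> {1..n} \<Longrightarrow> finite (F i)"
    and incl_one: "\<iota> 1 = 1"
    and incl_add: "\<And>a b. a \<in> R_ring F n \<Longrightarrow> b \<in> R_ring F n \<Longrightarrow> \<iota> (a + b) = \<iota> a + \<iota> b"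
    and incl_mult: "\<And>a b. a \<in> R_ring F n \<Longrightarrow> b \<in> R_ring F n \<Longrightarrow> \<iota> (a * b) = \<iota> a * \<iota> b"
    and incl_inj: "inj_on \<iota> (R_ring F n)"
    and Ore: "\<And>i. i \<in> {1..n} \<Longrightarrow> Ore_domain (D i)"
    and tower: "\<And>i j. 1 \<le> i \<Longrightarrow> i \<le> j \<Longrightarrow> j \<le> n \<Longrightarrow> D i \<subseteq> D j"
    and R_subset: "\<And>i. i \<in> {1..n} \<Longrightarrow> \<iota> ` R_ring F i \<subseteq> D i"
    and t_nonzero: "\<And>i. i \<in> {1..n} \<Longrightarrow> t i \<noteq> 0"
    and t_in: "\<And>i. i \<in> {1..n} \<Longrightarrow> t i \<in> D i"
    and t_inverse_in: "\<And>i. i \<in> {1..n} \<Longrightarrow> inverse (t i) \<in> D i"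
    and t_commute: "\<And>i j. i \<in> {1..n} \<Longrightarrow> j \<in> {1..n} \<Longrightarrow> i \<noteq> j \<Longrightarrow> t i * t j = t j * t i"
    and t_frozen_commute: "\<And>i j f. i \<in> {1..n} \<Longrightarrow> j \<in> {1..n} \<Longrightarrow> i \<noteq> j \<Longrightarrow> f \<in> F j \<Longrightarrow>
          t i * \<iota> (frozen_var f) = \<iota> (frozen_var f) * t i"
    and basis_span: "\<And>i d. i \<in> {1..n} \<Longrightarrow> d \<in> D i \<Longrightarrow>
          \<exists>S c. finite S \<and> S \<subseteq> exponents i \<and> (\<forall>\<alpha>\<in>S. c \<alpha> \<in> R_ring F i) \<and>
            d = (\<Sum>\<alpha>\<in>S. \<iota> (c \<alpha>) * t_monomial t i \<alpha>)"
    and basis_independent: "\<And>i S c. i \<in> {1..n} \<Longrightarrow> finite S \<Longrightarrow> S \<subseteq> exponents i \<Longrightarrow>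
          (\<forall>\<alpha>\<in>S. c \<alpha> \<in> R_ring F i) \<Longrightarrow> (\<Sum>\<alpha>\<in>S. \<iota> (c \<alpha>) * t_monomial t i \<alpha>) = 0 \<Longrightarrow>
          (\<forall>\<alpha>\<in>S. c \<alpha> = 0)"


section \<open>Valued star quivers\<close>

text \<open>An arrow \<open>(i, j)\<close> carries the valuation \<open>(val i j, val j i)\<close>.\<close>

record 'v valued_quiver =
  verts :: "'v set"
  arrows :: "('v \<times> 'v) set"
  val :: "'v \<Rightarrow> 'v \<Rightarrow> nat"

definition is_valued_quiver :: "'v valued_quiver \<Rightarrow> bool" where
  "is_valued_quiver G \<longleftrightarrow>
     finite (verts G) \<and> arrows G \<subseteq> verts G \<times> verts G \<and>
     (\<forall>i. (i, i) \<notin> arrows G) \<and>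
     (\<forall>i j. (i, j) \<in> arrows G \<longrightarrow> (j, i) \<notin> arrows G) \<and>
     (\<forall>i j. (i, j) \<in> arrows G \<longrightarrow> val G i j > 0 \<and> val G j i > 0) \<and>
     (\<exists>d :: 'v \<Rightarrow> nat. (\<forall>i\<in>verts G. d i > 0) \<and>
        (\<forall>i j. (i, j) \<in> arrows G \<longrightarrow> d i * val G i j = val G j i * d j))"

definition star_quiver :: "'v \<Rightarrow> 'v valued_quiver \<Rightarrow> bool" where
  "star_quiver k G \<longleftrightarrow> is_valued_quiver G \<and> k \<in> verts G \<and>
     (\<forall>i j. (i, j) \<in> arrows G \<longrightarrow> i = k \<or> j = k)"

definition balanced_star :: "'v \<Rightarrow> nat \<Rightarrow> 'v valued_quiver \<Rightarrow> bool" where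
  "balanced_star k a G \<longleftrightarrow>
     (\<Sum>j | (k, j) \<in> arrows G. val G k j) = a \<and>
     (\<Sum>j | (k, j) \<in> arrows G. val G j k) = a \<and>
     (\<Sum>i | (i, k) \<in> arrows G. val G i k) = a \<and>
     (\<Sum>i | (i, k) \<in> arrows G. val G k i) = a"

text \<open>
  Reversal exchanges the numbers \<open>val i j\<close> and \<open>val j i\<close>. Hence the exponent that
  \<open>exchange_element\<close> below reads off an arrow, namely \<open>val i j\<close> for the arrow \<open>(i, j)\<close>,
  is the same for the reversed arrow; left and right mutations are then mutually inverse.
\<close>

definition reverse_quiver :: "'v valued_quiver \<Rightarrow> 'v valued_quiver" where
  "reverse_quiver G = \<lparr>verts = verts G, arrows = (arrows G)\<inverse>, val = (\<lambda>i j. val G j i)\<rparr>"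


section \<open>Preseeds and mutations\<close>

text \<open>
  In \<open>(F, X, \<Gamma>)\<close> only the indices in \<open>{1..n}\<close> matter. The center of \<open>\<Gamma> k\<close> is
  \<open>None\<close>; the vertex of the frozen variable \<open>f\<close> is \<open>Some f\<close>.
\<close>

type_synonym ('f, 'd) preseed =
  "(nat \<Rightarrow> 'f set) \<times> (nat \<Rightarrow> 'd) \<times> (nat \<Rightarrow> 'f option valued_quiver)"

definition R_automorphism ::
  "(nat \<Rightarrow> 'f set) \<Rightarrow> (('f, 'k::field_char_0) group_ring \<Rightarrow> 'd::division_ring) \<Rightarrow>
   (nat \<Rightarrow> 'd set) \<Rightarrow> nat \<Rightarrow> ('d \<Rightarrow> 'd) \<Rightarrow> bool" where
  "R_automorphism F \<iota> D k \<phi> \<longleftrightarrow>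
     bij_betw \<phi> (right_fractions (D k)) (right_fractions (D k)) \<and>
     (\<forall>a\<in>right_fractions (D k). \<forall>b\<in>right_fractions (D k).
        \<phi> (a + b) = \<phi> a + \<phi> b \<and> \<phi> (a * b) = \<phi> a * \<phi> b) \<and>
     (\<forall>r\<in>R_ring F k. \<forall>a\<in>right_fractions (D k). \<phi> (\<iota> r * a) = \<iota> r * \<phi> a) \<and>
     (\<forall>j\<in>{1..k}. \<forall>f\<in>F j. \<phi> (\<iota> (frozen_var f)) = \<iota> (frozen_var f))"

fun is_preseed ::
  "nat \<Rightarrow> (('f, 'k::field_char_0) group_ring \<Rightarrow> 'd::division_ring) \<Rightarrow>
   (nat \<Rightarrow> 'd set) \<Rightarrow> (nat \<Rightarrow> 'd) \<Rightarrow> ('f, 'd) preseed \<Rightarrow> bool" where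
  "is_preseed n \<iota> D t (F, X, \<Gamma>) \<longleftrightarrow>
     (\<forall>k\<in>{1..n}. (\<exists>\<phi>. R_automorphism F \<iota> D k \<phi> \<and> X k = \<phi> (t k)) \<and>
        star_quiver None (\<Gamma> k) \<and> verts (\<Gamma> k) = insert None (Some ` F k))"

fun balanced_preseed :: "nat \<Rightarrow> ('f, 'd) preseed \<Rightarrow> bool" where
  "balanced_preseed n (F, X, \<Gamma>) \<longleftrightarrow> (\<forall>k\<in>{1..n}. \<exists>a. balanced_star None a (\<Gamma> k))"

definition exchange_element :: "'f option valued_quiver \<Rightarrow> ('f, 'k::field_char_0) group_ring" where
  "exchange_element G =
     (\<Prod>f | (Some f, None) \<in> arrows G. frozen_var f ^ val G (Some f) None) +
     (\<Prod>f | (None, Some f) \<in> arrows G. frozen_var f ^ val G None (Some f))"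

fun right_mutation ::
  "(('f, 'k::field_char_0) group_ring \<Rightarrow> 'd::division_ring) \<Rightarrow> nat \<Rightarrow>
   ('f, 'd) preseed \<Rightarrow> ('f, 'd) preseed" where
  "right_mutation \<iota> k (F, X, \<Gamma>) =
     (F, X(k := \<iota> (exchange_element (\<Gamma> k)) * inverse (X k)), \<Gamma>(k := reverse_quiver (\<Gamma> k)))"

fun left_mutation ::
  "(('f, 'k::field_char_0) group_ring \<Rightarrow> 'd::division_ring) \<Rightarrow> nat \<Rightarrow>
   ('f, 'd) preseed \<Rightarrow> ('f, 'd) preseed" where
  "left_mutation \<iota> k (F, X, \<Gamma>) =
     (F, X(k := inverse (X k) * \<iota> (exchange_element (\<Gamma> k))), \<Gamma>(k := reverse_quiver (\<Gamma> k)))"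

inductive mutation_equivalent ::
  "nat \<Rightarrow> (('f, 'k::field_char_0) group_ring \<Rightarrow> 'd::division_ring) \<Rightarrow>
   ('f, 'd) preseed \<Rightarrow> ('f, 'd) preseed \<Rightarrow> bool"
  for n \<iota> p where
  refl: "mutation_equivalent n \<iota> p p"
| right: "mutation_equivalent n \<iota> p p' \<Longrightarrow> k \<in> {1..n} \<Longrightarrow>
            mutation_equivalent n \<iota> p (right_mutation \<iota> k p')"
| left: "mutation_equivalent n \<iota> p p' \<Longrightarrow> k \<in> {1..n} \<Longrightarrow>
            mutation_equivalent n \<iota> p (left_mutation \<iota> k p')"

definition cluster_variables ::
  "nat \<Rightarrow> (('f, 'k::field_char_0) group_ring \<Rightarrow> 'd::division_ring) \<Rightarrow>
   ('f, 'd) preseed \<Rightarrow> 'd set" where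
  "cluster_variables n \<iota> p =
     {X' i | F' X' \<Gamma>' i. mutation_equivalent n \<iota> p (F', X', \<Gamma>') \<and> i \<in> {1..n}}"

end

theory Submission
  imports Defs
begin

text \<open>
  Fix a vertex \<open>k\<close> and write \<open>x = X k\<close>, \<open>z = \<iota> \<xi>\<^sub>k\<close> and \<open>Q = \<iota> (scalar q)\<close>. A mutation at \<open>k\<close>
  changes only the \<open>k\<close>-th cluster variable and the \<open>k\<close>-th quiver, and reversing a quiver
  does not change its exchange element, so mutating at \<open>k\<close> repeatedly means iterating \<open>u \<mapsto> z u\<^sup>-\<^sup>1\<close> and \<open>u \<mapsto> u\<^sup>-\<^sup>1 z\<close> with one
  and the same \<open>z\<close>. Different vertices do not interact.

  Balance says that both monomials of \<open>\<xi>\<^sub>k\<close> have the same degree \<open>a\<close>. Moving \<open>x\<close> past a frozen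
  variable costs one factor \<open>Q\<close>, hence \<open>z x = c x z\<close> with \<open>c = Q ^ a\<close>, where \<open>c\<close> and
  \<open>z\<close> commute because group rings of abelian groups are commutative. This confines the orbit
  of \<open>x\<close> to the elements \<open>c\<^sup>j x\<close> and \<open>x\<^sup>-\<^sup>1 z c\<^sup>j\<close> with \<open>j\<close> an integer
  (lemmas \<open>right_mutation_orbit\<close> and
  \<open>left_mutation_orbit\<close>), and two right mutations send \<open>c\<^sup>j x\<close> to \<open>c\<^sup>j\<^sup>+\<^sup>1 x\<close>.

  If \<open>q\<close> is a root of unity, then \<open>c\<close> has finitely many powers at each vertex, and there are
  finitely many cluster variables. Conversely, at a vertex whose quiver has an arrow the degree
  \<open>a\<close> is positive; if there are finitely many cluster variables, two of the \<open>c\<^sup>j x\<close> coincide,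
  some positive power of \<open>Q\<close> is \<open>1\<close>, and injectivity of \<open>\<iota>\<close> carries this back to \<open>q\<close>.
\<close>


section \<open>Orbits of the mutation maps in a division ring\<close>

lemma power_int_commute_elem:
  fixes c z :: "'d::division_ring"
  assumes "c * z = z * c"
  shows "c powi j * z = z * c powi j"
proof -
  have "inverse c * z = z * inverse c"
    using mult_commute_imp_mult_inverse_commute[OF assms] .
  then show ?thesis
    using assms by (simp add: power_int_def power_commuting_commutes)
qed

lemma inverse_mult_division_ring:
  fixes u v :: "'d::division_ring"
  shows "inverse (u * v) = inverse v * inverse u"
  by (cases "u = 0 \<or> v = 0") (auto simp: nonzero_inverse_mult_distrib)

definition mutation_orbit :: "'d::division_ring \<Rightarrow> 'd \<Rightarrow> 'd \<Rightarrow> 'd set" where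
  "mutation_orbit c z x =
     range (\<lambda>j::int. c powi j * x) \<union> range (\<lambda>j::int. inverse x * z * c powi j)"

text \<open>
  The two mutations of each kind of element. The powers of \<open>c\<close> stay to the left of \<open>x\<close> and to
  the right of \<open>x\<^sup>-\<^sup>1 z\<close>, because \<open>c\<close> is only known to commute with \<open>z\<close>.
\<close>

lemma mutations_of_orbit_elements:
  fixes c z x :: "'d::division_ring"
  assumes nz: "c \<noteq> 0" "z \<noteq> 0" "x \<noteq> 0"
    and cz: "c * z = z * c" and zx: "z * x = c * x * z"
  shows "z * inverse (c powi j * x) = inverse x * z * c powi (- j - 1)"
    and "inverse (c powi j * x) * z = inverse x * z * c powi (- j)"
    and "z * inverse (inverse x * z * c powi j) = c powi (- j) * x"
    and "inverse (inverse x * z * c powi j) * z = c powi (- j - 1) * x"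
proof -
  note comm = power_int_commute_elem[OF cz]
  have inv: "inverse (c powi j) = c powi (- j)" for j
    by (simp add: power_int_minus)
  have step: "c powi (- j - 1) = inverse c * c powi (- j)" for j
  proof -
    have "- j - 1 = - 1 + - j" by simp
    then show ?thesis
      using power_int_add[of c "- 1" "- j"] nz(1) by (simp only: power_int_minus) simp
  qed
  have cinv: "inverse c * z = z * inverse c"
    using comm[of "-1"] by (simp add: power_int_minus)
  have pow_cinv: "c powi (- j) * inverse c = inverse c * c powi (- j)" for j
    by (rule power_int_commute_elem) (use nz in simp)
  have z_past_inv: "z * inverse x = inverse x * z * inverse c"
  proof -
    have "z * inverse x = inverse x * inverse c * (c * x * z) * inverse x"
      using nz by (simp add: mult.assoc[symmetric]) (simp add: mult.assoc)
    also have "\<dots> = inverse x * inverse c * (z * x) * inverse x"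
      by (simp only: zx)
    finally show ?thesis using nz by (simp add: mult.assoc cinv)
  qed
  have conj: "inverse z * x * z = inverse c * x"
  proof -
    have "inverse z * x * z = inverse z * inverse c * (c * x * z)"
      using nz by (simp add: mult.assoc) (simp add: mult.assoc[symmetric])
    also have "\<dots> = inverse z * inverse c * (z * x)"
      by (simp only: zx)
    also have "\<dots> = inverse z * (inverse c * z) * x"
      by (simp only: mult.assoc)
    also have "\<dots> = (inverse z * z) * inverse c * x"
      by (simp only: cinv mult.assoc)
    finally show ?thesis using nz by simp
  qed
  show "z * inverse (c powi j * x) = inverse x * z * c powi (- j - 1)"
    by (simp only: inverse_mult_division_ring inv step mult.assoc[symmetric] z_past_inv)
  show "inverse (c powi j * x) * z = inverse x * z * c powi (- j)"
    by (simp only: inverse_mult_division_ring inv mult.assoc comm)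
  have "z * inverse (inverse x * z * c powi j) = z * c powi (- j) * inverse z * x"
    by (simp only: inverse_mult_division_ring inv mult.assoc inverse_inverse_eq)
  also have "\<dots> = c powi (- j) * (z * inverse z) * x"
    by (simp only: comm[symmetric] mult.assoc)
  finally show "z * inverse (inverse x * z * c powi j) = c powi (- j) * x"
    using nz by simp
  have "inverse (inverse x * z * c powi j) * z = c powi (- j) * (inverse z * x * z)"
    by (simp only: inverse_mult_division_ring inv mult.assoc inverse_inverse_eq)
  also have "\<dots> = c powi (- j - 1) * x"
    by (simp only: conj step mult.assoc[symmetric] pow_cinv)
  finally show "inverse (inverse x * z * c powi j) * z = c powi (- j - 1) * x" .
qed

lemma right_mutation_orbit:
  fixes c z x :: "'d::division_ring"
  assumes "c \<noteq> 0" "z \<noteq> 0" "x \<noteq> 0" "c * z = z * c" "z * x = c * x * z"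
    and "u \<in> mutation_orbit c z x"
  shows "z * inverse u \<in> mutation_orbit c z x"
proof -
  obtain j where "u = c powi j * x \<or> u = inverse x * z * c powi j"
    using assms(6) unfolding mutation_orbit_def by blast
  then have "z * inverse u = inverse x * z * c powi (- j - 1) \<or> z * inverse u = c powi (- j) * x"
    using mutations_of_orbit_elements(1,3)[OF assms(1-5)] by blast
  then show ?thesis
    unfolding mutation_orbit_def by blast
qed

lemma left_mutation_orbit:
  fixes c z x :: "'d::division_ring"
  assumes "c \<noteq> 0" "z \<noteq> 0" "x \<noteq> 0" "c * z = z * c" "z * x = c * x * z"
    and "u \<in> mutation_orbit c z x"
  shows "inverse u * z \<in> mutation_orbit c z x"
proof -
  obtain j where "u = c powi j * x \<or> u = inverse x * z * c powi j"
    using assms(6) unfolding mutation_orbit_def by blast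
  then have "inverse u * z = inverse x * z * c powi (- j) \<or> inverse u * z = c powi (- j - 1) * x"
    using mutations_of_orbit_elements(2,4)[OF assms(1-5)] by blast
  then show ?thesis
    unfolding mutation_orbit_def by blast
qed

lemma start_in_mutation_orbit: "x \<in> mutation_orbit c z x"
  unfolding mutation_orbit_def by (intro UnI1 range_eqI[of _ _ 0]) simp

lemma two_right_mutations:
  fixes c z x :: "'d::division_ring"
  assumes "c \<noteq> 0" "z \<noteq> 0" "x \<noteq> 0" "c * z = z * c" "z * x = c * x * z"
  shows "z * inverse (z * inverse (c ^ j * x)) = c ^ Suc j * x"
proof -
  have "z * inverse (z * inverse (c powi int j * x)) = c powi (- (- int j - 1)) * x"
    by (simp only: mutations_of_orbit_elements(1,3)[OF assms])
  also have "- (- int j - 1) = int (Suc j)"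
    by simp
  finally show ?thesis
    by (simp only: power_int_of_nat)
qed

lemma finite_mutation_orbit:
  fixes c z x :: "'d::division_ring"
  assumes "m > 0" "c ^ m = 1"
  shows "finite (mutation_orbit c z x)"
proof -
  have "c \<noteq> 0"
    using assms by (auto simp: power_0_left)
  have "c powi j = c powi (j mod int m)" for j
  proof -
    have "c powi j = c powi (int m * (j div int m) + j mod int m)"
      by simp
    also have "\<dots> = (c powi int m) powi (j div int m) * c powi (j mod int m)"
      by (simp only: power_int_add[OF disjI1[OF \<open>c \<noteq> 0\<close>]] power_int_mult)
    finally show ?thesis using assms by simp
  qed
  moreover have "j mod int m \<in> {0..<int m}" for j
    using assms by simp
  ultimately have "range (\<lambda>j. c powi j) \<subseteq> (\<lambda>j. c powi j) ` {0..<int m}"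
    by blast
  then have "finite (range (\<lambda>j. c powi j))"
    by (rule finite_subset) simp
  then have "finite ((\<lambda>w. w * x) ` range (\<lambda>j. c powi j))"
    "finite ((\<lambda>w. inverse x * z * w) ` range (\<lambda>j. c powi j))"
    by blast+
  then show ?thesis
    unfolding mutation_orbit_def by (simp add: image_image)
qed


section \<open>Group rings\<close>

lemma group_ring_on_zero: "0 \<in> group_ring_on S"
  by (simp add: group_ring_on_def)

lemma group_ring_on_one: "1 \<in> group_ring_on S"
  by (auto simp: group_ring_on_def)

lemma group_ring_on_add:
  "p \<in> group_ring_on S \<Longrightarrow> r \<in> group_ring_on S \<Longrightarrow> p + r \<in> group_ring_on S"
  unfolding group_ring_on_def using keys_add[of p r] by blast

lemma group_ring_on_mult:
  fixes p r :: "('f, 'k::semiring_0) group_ring"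
  assumes "p \<in> group_ring_on S" "r \<in> group_ring_on S"
  shows "p * r \<in> group_ring_on S"
proof -
  have "Poly_Mapping.keys w \<subseteq> S" if "w \<in> Poly_Mapping.keys (p * r)" for w
  proof -
    obtain u v where "w = u + v" "u \<in> Poly_Mapping.keys p" "v \<in> Poly_Mapping.keys r"
      using \<open>w \<in> Poly_Mapping.keys (p * r)\<close> keys_mult[of p r] by blast
    then show ?thesis
      using assms keys_add[of u v] unfolding group_ring_on_def by blast
  qed
  then show ?thesis by (simp add: group_ring_on_def)
qed

lemma scalar_in_group_ring_on: "scalar c \<in> group_ring_on S"
  by (simp add: scalar_def group_ring_on_def)

lemma frozen_var_in_group_ring_on:
  "f \<in> S \<Longrightarrow> (frozen_var f :: ('f, 'k::comm_ring_1) group_ring) \<in> group_ring_on S"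
  by (simp add: frozen_var_def group_ring_on_def)

lemma scalar_mult: "scalar (c * d) = scalar c * scalar d"
  by (simp add: scalar_def mult_single)

lemma scalar_one: "scalar 1 = 1"
  by (simp add: scalar_def)

lemma scalar_eq_iff: "scalar c = scalar d \<longleftrightarrow> c = d"
  unfolding scalar_def by (metis lookup_single_eq)

definition is_monomial :: "('f, 'k::comm_ring_1) group_ring \<Rightarrow> bool" where
  "is_monomial p \<longleftrightarrow> (\<exists>u. p = Poly_Mapping.single u 1)"

lemma is_monomial_one: "is_monomial 1"
  unfolding is_monomial_def by (metis single_one)

lemma is_monomial_mult: "is_monomial p \<Longrightarrow> is_monomial r \<Longrightarrow> is_monomial (p * r)"
  unfolding is_monomial_def by (metis mult_single mult_1)

lemma is_monomial_frozen_power: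
  "is_monomial ((frozen_var f :: ('f, 'k::comm_ring_1) group_ring) ^ e)"
proof (induction e)
  case 0
  show ?case by (simp add: is_monomial_one)
next
  case (Suc e)
  have "is_monomial (frozen_var f :: ('f, 'k) group_ring)"
    unfolding is_monomial_def frozen_var_def by blast
  then show ?case
    using Suc by (simp add: is_monomial_mult)
qed

lemma is_monomial_prod:
  "(\<And>i. i \<in> I \<Longrightarrow> is_monomial (g i)) \<Longrightarrow> is_monomial (\<Prod>i\<in>I. g i)"
  by (induction I rule: infinite_finite_induct) (auto simp: is_monomial_one is_monomial_mult)

text \<open>The two monomials may coincide, but then their sum is twice a monomial,
  which does not vanish in characteristic zero.\<close>

lemma exchange_element_nonzero: "(exchange_element G :: ('f, 'k::field_char_0) group_ring) \<noteq> 0"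
proof -
  have "is_monomial (\<Prod>f | (Some f, None) \<in> arrows G.
      (frozen_var f :: ('f, 'k) group_ring) ^ val G (Some f) None)"
    "is_monomial (\<Prod>f | (None, Some f) \<in> arrows G.
      (frozen_var f :: ('f, 'k) group_ring) ^ val G None (Some f))"
    by (intro is_monomial_prod is_monomial_frozen_power)+
  then obtain u v where "(exchange_element G :: ('f, 'k) group_ring) =
      Poly_Mapping.single u 1 + Poly_Mapping.single v 1"
    unfolding exchange_element_def is_monomial_def by metis
  then have "Poly_Mapping.lookup (exchange_element G :: ('f, 'k) group_ring) u \<noteq> 0"
    by (simp add: lookup_add lookup_single when_def)
  then show ?thesis by auto
qed

lemma exchange_element_reverse: "exchange_element (reverse_quiver G) = exchange_element G"
  by (simp add: exchange_element_def reverse_quiver_def add.commute)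


section \<open>The commutation relation at a vertex\<close>

context ambient_tower
begin

lemma incl_zero: "\<iota> 0 = 0"
  using incl_add[OF group_ring_on_zero group_ring_on_zero] by simp

lemma incl_nonzero: "p \<in> R_ring F n \<Longrightarrow> p \<noteq> 0 \<Longrightarrow> \<iota> p \<noteq> 0"
  using inj_onD[OF incl_inj _ _ group_ring_on_zero, of p] incl_zero by auto

lemma incl_scalar_power: "\<iota> (scalar c) ^ m = \<iota> (scalar (c ^ m))"
  by (induction m)
    (simp_all add: scalar_one incl_one scalar_mult incl_mult scalar_in_group_ring_on)

lemma incl_scalar_power_eq_one_iff: "\<iota> (scalar c) ^ m = 1 \<longleftrightarrow> c ^ m = 1"
proof -
  have "\<iota> (scalar c) ^ m = 1 \<longleftrightarrow> \<iota> (scalar (c ^ m)) = \<iota> (scalar 1)"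
    by (simp add: incl_scalar_power scalar_one incl_one)
  also have "\<dots> \<longleftrightarrow> c ^ m = 1"
    using inj_onD[OF incl_inj _ scalar_in_group_ring_on scalar_in_group_ring_on]
    by (auto simp: scalar_eq_iff)
  finally show ?thesis .
qed

lemma incl_scalar_power_commute:
  assumes "p \<in> R_ring F n"
  shows "\<iota> (scalar c) ^ m * \<iota> p = \<iota> p * \<iota> (scalar c) ^ m"
  unfolding incl_scalar_power incl_mult[OF assms scalar_in_group_ring_on, symmetric]
    incl_mult[OF scalar_in_group_ring_on assms, symmetric]
  by (simp only: mult.commute)

text \<open>
  Elements of the group ring that pick up a factor \<open>q ^ d\<close> when they pass \<open>x\<close>. For monomials
  in the frozen variables of one vertex, \<open>d\<close> is the total degree.
\<close>

definition passes_with_degree :: "'k \<Rightarrow> 'd \<Rightarrow> nat \<Rightarrow> ('f, 'k) group_ring \<Rightarrow> bool" where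
  "passes_with_degree q x d p \<longleftrightarrow>
     p \<in> R_ring F n \<and> \<iota> p * x = \<iota> (scalar q) ^ d * x * \<iota> p"

lemma passes_with_degree_one: "passes_with_degree q x 0 1"
  by (simp add: passes_with_degree_def group_ring_on_one incl_one)

lemma passes_with_degree_mult:
  assumes "passes_with_degree q x d p" "passes_with_degree q x e r"
  shows "passes_with_degree q x (d + e) (p * r)"
proof -
  let ?Q = "\<iota> (scalar q)"
  have mem: "p \<in> R_ring F n" "r \<in> R_ring F n"
    and p: "\<iota> p * x = ?Q ^ d * x * \<iota> p" and r: "\<iota> r * x = ?Q ^ e * x * \<iota> r"
    using assms by (auto simp: passes_with_degree_def)
  have "\<iota> (p * r) * x = \<iota> p * (?Q ^ e * x * \<iota> r)"
    by (simp only: incl_mult[OF mem] mult.assoc r[unfolded mult.assoc])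
  also have "\<dots> = ?Q ^ e * (\<iota> p * x) * \<iota> r"
    by (simp only: mult.assoc[symmetric] incl_scalar_power_commute[OF mem(1)])
  also have "\<dots> = ?Q ^ (d + e) * x * \<iota> (p * r)"
    by (simp only: p incl_mult[OF mem] mult.assoc power_add add.commute[of d])
  finally show ?thesis
    using mem by (simp add: passes_with_degree_def group_ring_on_mult)
qed

lemma passes_with_degree_power:
  "passes_with_degree q x d p \<Longrightarrow> passes_with_degree q x (m * d) (p ^ m)"
  by (induction m) (auto simp: passes_with_degree_one passes_with_degree_mult)

lemma passes_with_degree_prod:
  "(\<And>i. i \<in> I \<Longrightarrow> passes_with_degree q x (d i) (g i)) \<Longrightarrow>
     passes_with_degree q x (\<Sum>i\<in>I. d i) (\<Prod>i\<in>I. g i)"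
  by (induction I rule: infinite_finite_induct)
    (auto simp: passes_with_degree_one passes_with_degree_mult)

lemma passes_with_degree_add:
  assumes "passes_with_degree q x d p" "passes_with_degree q x d r"
  shows "passes_with_degree q x d (p + r)"
proof -
  have mem: "p \<in> R_ring F n" "r \<in> R_ring F n"
    and eqs: "\<iota> p * x = \<iota> (scalar q) ^ d * x * \<iota> p" "\<iota> r * x = \<iota> (scalar q) ^ d * x * \<iota> r"
    using assms by (auto simp: passes_with_degree_def)
  show ?thesis
    unfolding passes_with_degree_def incl_add[OF mem] distrib_left distrib_right eqs
    using group_ring_on_add[OF mem] by blast
qed

end

lemma sum_over_star_leaves:
  assumes "\<And>v. P v \<Longrightarrow> v \<noteq> None"
  shows "(\<Sum>f | P (Some f). g (Some f)) = (\<Sum>v | P v. g v)"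
proof (rule sum.reindex_cong[symmetric])
  show "inj_on Some {f. P (Some f)}" by simp
  show "{v. P v} = Some ` {f. P (Some f)}"
    using assms by (auto simp: image_iff)
qed simp

text \<open>
  This is where balance enters: both monomials have the same degree \<open>a\<close>, so that one common
  factor \<open>q ^ a\<close> comes out of their sum.
\<close>

lemma (in ambient_tower) exchange_element_passes:
  assumes star: "star_quiver None G" "verts G = insert None (Some ` F k)" and k: "k \<in> {1..n}"
    and bal: "balanced_star None a G"
    and frozen: "\<And>f. f \<in> F k \<Longrightarrow>
      \<iota> (frozen_var f) * x = \<iota> (scalar q) * x * \<iota> (frozen_var f)"
  shows "passes_with_degree q x a (exchange_element G)"
proof -
  have no_loop: "(v, v) \<notin> arrows G" and arrows: "arrows G \<subseteq> verts G \<times> verts G" for v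
    using star by (auto simp: star_quiver_def is_valued_quiver_def)
  have var: "passes_with_degree q x e (frozen_var f ^ e)" if "f \<in> F k" for f e
  proof -
    have "f \<in> (\<Union>j\<in>{1..n}. F j)" using that k by blast
    then have "passes_with_degree q x 1 (frozen_var f)"
      using frozen[OF that] by (simp add: passes_with_degree_def frozen_var_in_group_ring_on)
    then show ?thesis
      using passes_with_degree_power[of q x 1 "frozen_var f" e] by simp
  qed
  have not_center: "v \<noteq> None" if "(v, None) \<in> arrows G \<or> (None, v) \<in> arrows G" for v
    using that no_loop by metis
  have leaf: "f \<in> F k" if "(Some f, None) \<in> arrows G \<or> (None, Some f) \<in> arrows G" for f
    using that arrows star(2) by auto
  have "(\<Sum>f | (Some f, None) \<in> arrows G. val G (Some f) None) =
      (\<Sum>v | (v, None) \<in> arrows G. val G v None)"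
    by (rule sum_over_star_leaves[of "\<lambda>v. (v, None) \<in> arrows G" "\<lambda>v. val G v None"])
      (use not_center in blast)
  also have "\<dots> = a"
    using bal unfolding balanced_star_def by blast
  finally have deg_in: "(\<Sum>f | (Some f, None) \<in> arrows G. val G (Some f) None) = a" .
  have "(\<Sum>f | (None, Some f) \<in> arrows G. val G None (Some f)) =
      (\<Sum>v | (None, v) \<in> arrows G. val G None v)"
    by (rule sum_over_star_leaves[of "\<lambda>v. (None, v) \<in> arrows G" "\<lambda>v. val G None v"])
      (use not_center in blast)
  also have "\<dots> = a"
    using bal unfolding balanced_star_def by blast
  finally have deg_out: "(\<Sum>f | (None, Some f) \<in> arrows G. val G None (Some f)) = a" .
  show ?thesis
    unfolding exchange_element_def
  proof (rule passes_with_degree_add)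
    show "passes_with_degree q x a
        (\<Prod>f | (Some f, None) \<in> arrows G. frozen_var f ^ val G (Some f) None)"
      by (subst deg_in[symmetric], rule passes_with_degree_prod) (auto intro!: var leaf)
    show "passes_with_degree q x a
        (\<Prod>f | (None, Some f) \<in> arrows G. frozen_var f ^ val G None (Some f))"
      by (subst deg_out[symmetric], rule passes_with_degree_prod) (auto intro!: var leaf)
  qed
qed

lemma balanced_degree_pos:
  assumes "star_quiver None G" "balanced_star None a G" "arrows G \<noteq> {}"
  shows "a > 0"
proof -
  have fin: "finite (arrows G)"
  proof (rule finite_subset)
    show "arrows G \<subseteq> verts G \<times> verts G"
      using assms(1) unfolding star_quiver_def is_valued_quiver_def by blast
    show "finite (verts G \<times> verts G)"
      using assms(1) by (simp add: star_quiver_def is_valued_quiver_def)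
  qed
  have pos: "val G i j > 0" if "(i, j) \<in> arrows G" for i j
    using assms(1) that by (auto simp: star_quiver_def is_valued_quiver_def)
  have finite_ends: "finite {j. (None, j) \<in> arrows G}" "finite {i. (i, None) \<in> arrows G}"
    by (rule finite_subset[OF _ finite_imageI[OF fin, of snd]], force)
      (rule finite_subset[OF _ finite_imageI[OF fin, of fst]], force)
  obtain i j where ij: "(i, j) \<in> arrows G"
    using assms(3) by auto
  then consider "i = None" | "j = None"
    using assms(1) unfolding star_quiver_def by blast
  then show ?thesis
  proof cases
    case 1
    then have "val G None j \<le> (\<Sum>j | (None, j) \<in> arrows G. val G None j)"
      using ij finite_ends by (intro member_le_sum) auto
    then show ?thesis
      using pos[OF ij] 1 assms(2) by (simp add: balanced_star_def)
  next
    case 2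
    then have "val G i None \<le> (\<Sum>i | (i, None) \<in> arrows G. val G i None)"
      using ij finite_ends by (intro member_le_sum) auto
    then show ?thesis
      using pos[OF ij] 2 assms(2) by (simp add: balanced_star_def)
  qed
qed

lemma (in ambient_tower) automorphism_image_nonzero:
  assumes k: "k \<in> {1..n}" and \<phi>: "R_automorphism F \<iota> D k \<phi>"
  shows "\<phi> (t k) \<noteq> 0"
proof -
  have sub: "1 \<in> D k" "\<And>a b. a \<in> D k \<Longrightarrow> b \<in> D k \<Longrightarrow> a - b \<in> D k"
    using Ore[OF k] by (auto simp: Ore_domain_def subring_of_def)
  then have D_frac: "d \<in> right_fractions (D k)" if "d \<in> D k" for d
    unfolding right_fractions_def using that
    by (intro CollectI exI[of _ d] exI[of _ 1]) auto
  have zero: "0 \<in> right_fractions (D k)"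
    using D_frac sub(2)[OF sub(1) sub(1)] by simp
  have inj: "inj_on \<phi> (right_fractions (D k))"
    using \<phi> by (auto simp: R_automorphism_def bij_betw_def)
  have "\<phi> (0 + 0) = \<phi> 0 + \<phi> 0"
    using \<phi> zero unfolding R_automorphism_def by blast
  then have "\<phi> 0 = 0" by simp
  then show ?thesis
    using inj_onD[OF inj _ D_frac[OF t_in[OF k]] zero] t_nonzero[OF k] by auto
qed


section \<open>Cluster variables\<close>

text \<open>
  The exchange elements are constant along mutation sequences, so closure under the two
  mutation maps at each vertex confines all cluster variables.
\<close>

lemma cluster_variables_confined:
  fixes \<iota> :: "('f, 'k::field_char_0) group_ring \<Rightarrow> 'd::division_ring"
  assumes start: "\<And>k. k \<in> {1..n} \<Longrightarrow> X k \<in> C k"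
    and right: "\<And>k u. k \<in> {1..n} \<Longrightarrow> u \<in> C k \<Longrightarrow>
      \<iota> (exchange_element (\<Gamma> k)) * inverse u \<in> C k"
    and left: "\<And>k u. k \<in> {1..n} \<Longrightarrow> u \<in> C k \<Longrightarrow>
      inverse u * \<iota> (exchange_element (\<Gamma> k)) \<in> C k"
  shows "cluster_variables n \<iota> (F, X, \<Gamma>) \<subseteq> (\<Union>k\<in>{1..n}. C k)"
proof -
  have "\<forall>k\<in>{1..n}. fst (snd p) k \<in> C k \<and>
      (exchange_element (snd (snd p) k) = (exchange_element (\<Gamma> k) :: ('f, 'k) group_ring))"
    if "mutation_equivalent n \<iota> (F, X, \<Gamma>) p" for p
    using that
  proof induction
    case refl
    show ?case using start by simp
  next
    case (right p k)
    then show ?case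
      by (cases p) (auto simp: exchange_element_reverse assms(2))
  next
    case (left p k)
    then show ?case
      by (cases p) (auto simp: exchange_element_reverse assms(3))
  qed
  from this[of "(_, _, _)"] show ?thesis
    unfolding cluster_variables_def by fastforce
qed

lemma iterated_right_mutations:
  fixes \<iota> :: "('f, 'k::field_char_0) group_ring \<Rightarrow> 'd::division_ring"
  assumes k: "k \<in> {1..n}"
  shows "((\<lambda>u. \<iota> (exchange_element (\<Gamma> k)) * inverse u) ^^ j) (X k)
    \<in> cluster_variables n \<iota> (F, X, \<Gamma>)"
proof -
  let ?u = "\<lambda>j. ((\<lambda>u. \<iota> (exchange_element (\<Gamma> k)) * inverse u) ^^ j) (X k)"
  have "\<exists>X' \<Gamma>'. mutation_equivalent n \<iota> (F, X, \<Gamma>) (F, X', \<Gamma>') \<and> X' k = ?u j \<and>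
      exchange_element (\<Gamma>' k) = (exchange_element (\<Gamma> k) :: ('f, 'k) group_ring)"
  proof (induction j)
    case 0
    show ?case by (intro exI[of _ X] exI[of _ \<Gamma>]) (simp add: mutation_equivalent.refl)
  next
    case (Suc j)
    then obtain X' \<Gamma>' where p: "mutation_equivalent n \<iota> (F, X, \<Gamma>) (F, X', \<Gamma>')" "X' k = ?u j"
      "exchange_element (\<Gamma>' k) = (exchange_element (\<Gamma> k) :: ('f, 'k) group_ring)"
      by blast
    show ?case
      using mutation_equivalent.right[OF p(1) k]
      by (auto simp: p exchange_element_reverse intro!: exI)
  qed
  then obtain X' \<Gamma>' where "mutation_equivalent n \<iota> (F, X, \<Gamma>) (F, X', \<Gamma>')" "?u j = X' k"
    by metis
  then show ?thesis
    unfolding cluster_variables_def using k by blast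
qed

theorem corollary1p2:
  fixes n :: nat
    and F :: "nat \<Rightarrow> 'f set"
    and \<iota> :: "('f, 'k::field_char_0) group_ring \<Rightarrow> 'd::division_ring"
    and D :: "nat \<Rightarrow> 'd set"
    and t X :: "nat \<Rightarrow> 'd"
    and \<Gamma> :: "nat \<Rightarrow> 'f option valued_quiver"
    and q :: 'k
  assumes "ambient_tower n F \<iota> D t"
    and "is_preseed n \<iota> D t (F, X, \<Gamma>)"
    and "balanced_preseed n (F, X, \<Gamma>)"
    and nondegenerate: "\<exists>k\<in>{1..n}. arrows (\<Gamma> k) \<noteq> {}"
    and "q \<noteq> 0"
    and "\<And>i f. i \<in> {1..n} \<Longrightarrow> f \<in> F i \<Longrightarrow>
           \<iota> (frozen_var f) * X i = \<iota> (scalar q) * X i * \<iota> (frozen_var f)"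
  shows "finite (cluster_variables n \<iota> (F, X, \<Gamma>)) \<longleftrightarrow> (\<exists>m::nat. m > 0 \<and> q ^ m = 1)"
proof -
  interpret ambient_tower n F \<iota> D t by fact
  define Q where "Q = \<iota> (scalar q)"
  define z where "z k = \<iota> (exchange_element (\<Gamma> k))" for k
  have star: "star_quiver None (\<Gamma> k)" "verts (\<Gamma> k) = insert None (Some ` F k)"
    if "k \<in> {1..n}" for k
    using assms(2) that by auto
  have "\<forall>k\<in>{1..n}. \<exists>a. balanced_star None a (\<Gamma> k)"
    using assms(3) by simp
  then obtain a where a: "\<And>k. k \<in> {1..n} \<Longrightarrow> balanced_star None (a k) (\<Gamma> k)"
    by metis
  define c where "c k = Q ^ a k" for k
  have Q_nz: "Q \<noteq> 0"
    unfolding Q_def using assms(5) scalar_eq_iff[of q 0]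
    by (intro incl_nonzero scalar_in_group_ring_on) (simp add: scalar_def)
  have rel: "c k \<noteq> 0" "z k \<noteq> 0" "X k \<noteq> 0" "c k * z k = z k * c k" "z k * X k = c k * X k * z k"
    if k: "k \<in> {1..n}" for k
  proof -
    have passes: "passes_with_degree q (X k) (a k) (exchange_element (\<Gamma> k))"
      using exchange_element_passes[OF star[OF k] k a[OF k]] assms(6)[OF k] by blast
    then have mem: "(exchange_element (\<Gamma> k) :: ('f, 'k) group_ring) \<in> R_ring F n"
      unfolding passes_with_degree_def by blast
    show "z k * X k = c k * X k * z k"
      using passes unfolding passes_with_degree_def z_def c_def Q_def by blast
    show "c k * z k = z k * c k"
      using incl_scalar_power_commute[OF mem] by (simp add: c_def z_def Q_def)
    show "c k \<noteq> 0" using Q_nz by (simp add: c_def)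
    show "z k \<noteq> 0"
      unfolding z_def by (rule incl_nonzero[OF mem exchange_element_nonzero])
    obtain \<phi> where "R_automorphism F \<iota> D k \<phi>" "X k = \<phi> (t k)"
      using assms(2) k unfolding is_preseed.simps by blast
    then show "X k \<noteq> 0"
      using automorphism_image_nonzero[OF k] by simp
  qed
  show ?thesis
  proof
    assume fin: "finite (cluster_variables n \<iota> (F, X, \<Gamma>))"
    obtain k where k: "k \<in> {1..n}" and "arrows (\<Gamma> k) \<noteq> {}"
      using nondegenerate by blast
    then have "a k > 0"
      using balanced_degree_pos star(1) a by blast
    have iterate: "((\<lambda>u. z k * inverse u) ^^ (2 * j)) (X k) = c k ^ j * X k" for j
    proof (induction j)
      case (Suc j)
      have "((\<lambda>u. z k * inverse u) ^^ (2 * Suc j)) (X k) =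
          z k * inverse (z k * inverse (((\<lambda>u. z k * inverse u) ^^ (2 * j)) (X k)))"
        by simp
      also have "\<dots> = c k ^ Suc j * X k"
        unfolding Suc by (rule two_right_mutations[OF rel[OF k]])
      finally show ?case .
    qed simp
    have "c k ^ j * X k \<in> cluster_variables n \<iota> (F, X, \<Gamma>)" for j
      using iterated_right_mutations[OF k, where \<iota> = \<iota> and \<Gamma> = \<Gamma> and X = X and F = F
          and j = "2 * j"] iterate[of j] unfolding z_def by simp
    then have "finite (range (\<lambda>j. c k ^ j * X k))"
      by (intro finite_subset[OF _ fin]) blast
    then have "\<not> inj (\<lambda>j. c k ^ j * X k)"
      using finite_imageD infinite_UNIV_nat by blast
    then obtain i j where "i < j" "c k ^ i * X k = c k ^ j * X k"
      unfolding inj_def by (metis linorder_neqE_nat)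
    then have "c k ^ j = c k ^ i"
      using rel(3)[OF k] by simp
    moreover have "c k ^ j = c k ^ i * c k ^ (j - i)"
      using \<open>i < j\<close> by (simp flip: power_add)
    ultimately have "c k ^ (j - i) = 1"
      using rel(1)[OF k] by simp
    then have "q ^ (a k * (j - i)) = 1"
      by (simp add: c_def Q_def power_mult[symmetric] incl_scalar_power_eq_one_iff)
    then show "\<exists>m::nat. m > 0 \<and> q ^ m = 1"
      using \<open>a k > 0\<close> \<open>i < j\<close> by (intro exI[of _ "a k * (j - i)"]) simp
  next
    assume "\<exists>m::nat. m > 0 \<and> q ^ m = 1"
    then obtain m :: nat where m: "m > 0" "q ^ m = 1" by blast
    have "c k ^ m = 1" for k
    proof -
      have "c k ^ m = (Q ^ m) ^ a k"
        by (simp add: c_def power_mult[symmetric] mult.commute)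
      then show ?thesis
        using m incl_scalar_power_eq_one_iff[of q m] by (simp add: Q_def)
    qed
    then have "finite (\<Union>k\<in>{1..n}. mutation_orbit (c k) (z k) (X k))"
      using finite_mutation_orbit[OF m(1)] by blast
    moreover have "cluster_variables n \<iota> (F, X, \<Gamma>)
        \<subseteq> (\<Union>k\<in>{1..n}. mutation_orbit (c k) (z k) (X k))"
    proof (rule cluster_variables_confined)
      fix k u assume k: "k \<in> {1..n}" and u: "u \<in> mutation_orbit (c k) (z k) (X k)"
      show "\<iota> (exchange_element (\<Gamma> k)) * inverse u \<in> mutation_orbit (c k) (z k) (X k)"
        using right_mutation_orbit[OF rel[OF k] u] by (simp add: z_def)
      show "inverse u * \<iota> (exchange_element (\<Gamma> k)) \<in> mutation_orbit (c k) (z k) (X k)"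
        using left_mutation_orbit[OF rel[OF k] u] by (simp add: z_def)
    qed (rule start_in_mutation_orbit)
    ultimately show "finite (cluster_variables n \<iota> (F, X, \<Gamma>))"
      by (rule finite_subset[rotated])
  qed
qed

end
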